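(* Let $(S,\wedge,0)$ be a meet-semilattice with least element $0$ satisfying the Ascending Chain Condition and let $\rightarrow$ be a binary operator on $S$, i.e. a map assigning to every pair $(x,y)\in S^2$ a non-empty subset $x\rightarrow y$ of $S$. Then the following are equivalent: (i) $x\rightarrow y=\operatorname{Max}\{z\in S\mid x\wedge z\leq y\}$ for all $x,y\in S$; (ii) the operator $\rightarrow$ satisfies the following conditions for all $x,y,z\in S$: (R1) $x\rightarrow y$ is an antichain; (R2) $x\wedge(x\rightarrow y)\approx_1 x\wedge y$; (R3) $(x\rightarrow y)\wedge y\approx_1 y$; (R4) $x\rightarrow(y\wedge z)\approx_1(x\rightarrow y)\wedge(x\rightarrow z)$; (R5) $x\wedge(y\rightarrow y)\approx_1 x$; (R6) $y\leq z$ implies $x\rightarrow y\leq_1 x\rightarrow z$.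
   Context: The Ascending Chain Condition (ACC) means there is no infinite strictly ascending chain. Singletons are identified with their unique element (one writes $x$ for $\{x\}$). For a subset $A$ of a poset, $\operatorname{Max} A$ denotes the set of all maximal elements of $A$. For subsets $A,B$ of $S$: $A\leq_1 B$ means that for every $a\in A$ there exists some $b\in B$ with $a\leq b$; $A\approx_1 B$ means $A\leq_1 B$ and $B\leq_1 A$; and $A\wedge B:=\{a\wedge b\mid a\in A,\ b\in B\}$. When an element of $S$ occurs in one of these notations it stands for the corresponding singleton. The symbols $\leq_1$ and $\approx_1$ bind weaker than $\rightarrow$ and $\wedge$. *)

theory Defs
  imports Main
begin

definition ACC :: "'a::order itself \<Rightarrow> bool" where
  "ACC _ \<longleftrightarrow> \<not> (\<exists>c :: nat \<Rightarrow> 'a. strict_mono c)"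

(* Not to be confused with Max, the greatest element of a finite linearly ordered set. *)
definition maximal_elements :: "'a::order set \<Rightarrow> 'a set" where
  "maximal_elements A = {m \<in> A. \<not> (\<exists>a\<in>A. m < a)}"

definition antichain :: "'a::order set \<Rightarrow> bool" where
  "antichain A \<longleftrightarrow> (\<forall>a\<in>A. \<forall>b\<in>A. a \<le> b \<longrightarrow> a = b)"

definition le1 :: "'a::order set \<Rightarrow> 'a set \<Rightarrow> bool"  (infix "\<le>\<^sub>1" 50) where
  "A \<le>\<^sub>1 B \<longleftrightarrow> (\<forall>a\<in>A. \<exists>b\<in>B. a \<le> b)"

definition approx1 :: "'a::order set \<Rightarrow> 'a set \<Rightarrow> bool"  (infix "\<approx>\<^sub>1" 50) where
  "A \<approx>\<^sub>1 B \<longleftrightarrow> A \<le>\<^sub>1 B \<and> B \<le>\<^sub>1 A"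

(* The elementwise meet of two sets, not their intersection.  The identification of an element
   with its singleton is made explicit: x \<and> A becomes {x} \<sqinter>\<^sub>s A. *)
definition set_meet :: "'a::semilattice_inf set \<Rightarrow> 'a set \<Rightarrow> 'a set"  (infixl "\<sqinter>\<^sub>s" 70) where
  "A \<sqinter>\<^sub>s B = {inf a b | a b. a \<in> A \<and> b \<in> B}"

end

theory Submission
  imports Defs
begin

text \<open>
  Both conditions say that \<open>\<rightarrow>\<close> is a set-valued residual of the meet: every \<open>x \<rightarrow> y\<close> is an antichain,
  and \<open>inf x z \<le> y\<close> holds precisely when \<open>z\<close> lies below some element of \<open>x \<rightarrow> y\<close>.

  For (i) this is order theory only. The set of all \<open>z\<close> with \<open>inf x z \<le> y\<close> is downward closed, and
  under ACC each of its elements lies below a maximal one; so its set of maximal elements is the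
  unique antichain that generates it as a down-set (\<open>eq_maximal_elements_iff\<close>).

  For (ii), (R1) is the antichain condition, and (R2) to (R6) are equivalent to the residuation law
  (\<open>residuation_iff\<close>). The law yields (R2), (R3) and (R5) because \<open>inf x m \<le> y\<close> for \<open>m\<close> in \<open>x \<rightarrow> y\<close>,
  \<open>y\<close> lies below \<open>x \<rightarrow> y\<close>, and every element lies below \<open>y \<rightarrow> y\<close>; it yields (R4) and (R6) because
  \<open>inf x w \<le> y\<close> respects meets and is monotone in \<open>y\<close>. In the other direction, (R2) gives
  \<open>inf x z \<le> y\<close> for all \<open>z\<close> below \<open>x \<rightarrow> y\<close>. If, on the other hand, \<open>inf x z \<le> y\<close>, then \<open>z\<close> is below
  \<open>x \<rightarrow> x\<close> by (R5) and below \<open>x \<rightarrow> z\<close> by (R3), hence below \<open>x \<rightarrow> inf x z\<close> by (R4), and finally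
  below \<open>x \<rightarrow> y\<close> by (R6).
\<close>

text \<open>
  Under ACC the reversed strict order is well-founded, so the elements of \<open>W\<close> above \<open>z\<close> have
  a minimal element for it.
\<close>

lemma ACC_maximal_element_above:
  fixes W :: "'a::order set"
  assumes "ACC TYPE('a)" and "z \<in> W"
  shows "\<exists>m \<in> maximal_elements W. z \<le> m"
proof -
  have "wf {(b, a :: 'a). a < b}"
    using assms(1) by (auto simp: ACC_def wf_iff_no_infinite_down_chain strict_mono_Suc_iff)
  moreover have "z \<in> {w \<in> W. z \<le> w}"
    using assms(2) by simp
  ultimately obtain m where m: "m \<in> {w \<in> W. z \<le> w}"
    and max: "\<And>a. (a, m) \<in> {(b, a). a < b} \<Longrightarrow> a \<notin> {w \<in> W. z \<le> w}"
    by (rule wfE_min) blast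
  have "m \<in> maximal_elements W"
    using m max by (fastforce simp: maximal_elements_def)
  then show ?thesis
    using m by blast
qed

lemma antichain_maximal_elements: "antichain (maximal_elements W)"
  by (auto simp: antichain_def maximal_elements_def less_le)

text \<open>
  An antichain can be recovered from the down-set it generates, as the set of maximal elements.
  ACC is what makes a down-set recoverable from its maximal elements.
\<close>

lemma eq_maximal_elements_iff:
  fixes W :: "'a::order set"
  assumes acc: "ACC TYPE('a)"
    and down: "\<And>a b. b \<in> W \<Longrightarrow> a \<le> b \<Longrightarrow> a \<in> W"
  shows "A = maximal_elements W \<longleftrightarrow> antichain A \<and> (\<forall>z. z \<in> W \<longleftrightarrow> (\<exists>a\<in>A. z \<le> a))"
proof (intro iffI conjI allI)
  fix z
  assume A: "A = maximal_elements W"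
  show "antichain A"
    using A antichain_maximal_elements by blast
  show "\<exists>a\<in>A. z \<le> a" if "z \<in> W"
    using ACC_maximal_element_above[OF acc that] A by blast
  show "z \<in> W" if "\<exists>a\<in>A. z \<le> a"
    using that A down by (auto simp: maximal_elements_def)
next
  assume *: "antichain A \<and> (\<forall>z. z \<in> W \<longleftrightarrow> (\<exists>a\<in>A. z \<le> a))"
  then have anti: "\<And>a b. a \<in> A \<Longrightarrow> b \<in> A \<Longrightarrow> a \<le> b \<Longrightarrow> a = b"
    and W: "\<And>z. z \<in> W \<longleftrightarrow> (\<exists>a\<in>A. z \<le> a)"
    by (auto simp: antichain_def)
  show "A = maximal_elements W"
  proof (intro set_eqI iffI)
    fix m
    assume m: "m \<in> A"
    have "\<not> m < w" if w: "w \<in> W" for w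
    proof
      assume "m < w"
      also obtain a where a: "a \<in> A" "w \<le> a"
        using w W by blast
      note a(2)
      finally show False
        using anti[OF m a(1)] by (simp add: less_le)
    qed
    then show "m \<in> maximal_elements W"
      using m W by (auto simp: maximal_elements_def)
  next
    fix m
    assume m: "m \<in> maximal_elements W"
    then obtain a where a: "a \<in> A" "m \<le> a"
      using W by (auto simp: maximal_elements_def)
    then have "a \<in> W"
      using W by blast
    then have "m = a"
      using a m by (auto simp: maximal_elements_def less_le)
    then show "m \<in> A"
      using a by simp
  qed
qed

text \<open>
  Conditions formulated with \<open>\<le>\<^sub>1\<close> and \<open>\<approx>\<^sub>1\<close> see a set only through the down-set it generates, and
  the residuation law prescribes exactly these down-sets.
\<close>

lemma residuation_iff:
  fixes imp :: "'a::semilattice_inf \<Rightarrow> 'a \<Rightarrow> 'a set"  (infixr "\<rightarrow>" 75)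
  shows "(\<forall>x y z. inf x z \<le> y \<longleftrightarrow> (\<exists>m \<in> x \<rightarrow> y. z \<le> m)) \<longleftrightarrow>
    (\<forall>x y z.
      {x} \<sqinter>\<^sub>s (x \<rightarrow> y) \<approx>\<^sub>1 {inf x y} \<and>
      (x \<rightarrow> y) \<sqinter>\<^sub>s {y} \<approx>\<^sub>1 {y} \<and>
      x \<rightarrow> inf y z \<approx>\<^sub>1 (x \<rightarrow> y) \<sqinter>\<^sub>s (x \<rightarrow> z) \<and>
      {x} \<sqinter>\<^sub>s (y \<rightarrow> y) \<approx>\<^sub>1 {x} \<and>
      (y \<le> z \<longrightarrow> x \<rightarrow> y \<le>\<^sub>1 x \<rightarrow> z))"
    (is "?residuated \<longleftrightarrow> ?conditions")
proof (intro iffI allI conjI impI)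
  fix x y z
  assume ?residuated
  then have below: "\<And>x y z. inf x z \<le> y \<Longrightarrow> \<exists>m \<in> x \<rightarrow> y. z \<le> m"
    and meet: "\<And>x y m z. m \<in> x \<rightarrow> y \<Longrightarrow> z \<le> m \<Longrightarrow> inf x z \<le> y"
    by blast+
  obtain m where m: "m \<in> x \<rightarrow> y" "y \<le> m"
    using below[of x y y] by auto
  have "inf x y \<le> inf x m"
    using m by (simp add: le_infI2)
  then show "{x} \<sqinter>\<^sub>s (x \<rightarrow> y) \<approx>\<^sub>1 {inf x y}"
    using m meet[of _ x y] by (auto simp: approx1_def le1_def set_meet_def)
  show "(x \<rightarrow> y) \<sqinter>\<^sub>s {y} \<approx>\<^sub>1 {y}"
    using m by (auto simp: approx1_def le1_def set_meet_def)
  show "{x} \<sqinter>\<^sub>s (y \<rightarrow> y) \<approx>\<^sub>1 {x}"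
    using below[of y x y] by (auto simp: approx1_def le1_def set_meet_def)
  show "x \<rightarrow> y \<le>\<^sub>1 x \<rightarrow> z" if "y \<le> z"
    unfolding le1_def using below meet that order.trans by blast
  show "x \<rightarrow> inf y z \<approx>\<^sub>1 (x \<rightarrow> y) \<sqinter>\<^sub>s (x \<rightarrow> z)"
    unfolding approx1_def le1_def
  proof (intro conjI ballI)
    fix w
    assume "w \<in> x \<rightarrow> inf y z"
    then have "inf x w \<le> inf y z"
      using meet by blast
    then have "inf x w \<le> y" "inf x w \<le> z"
      by simp_all
    then obtain a b where "a \<in> x \<rightarrow> y" "w \<le> a" "b \<in> x \<rightarrow> z" "w \<le> b"
      using below by meson
    then show "\<exists>c \<in> (x \<rightarrow> y) \<sqinter>\<^sub>s (x \<rightarrow> z). w \<le> c"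
      unfolding set_meet_def by (blast intro: le_infI)
  next
    fix w
    assume "w \<in> (x \<rightarrow> y) \<sqinter>\<^sub>s (x \<rightarrow> z)"
    then obtain a b where "a \<in> x \<rightarrow> y" "b \<in> x \<rightarrow> z" "w = inf a b"
      by (auto simp: set_meet_def)
    then have "inf x w \<le> inf y z"
      using meet[of a x y w] meet[of b x z w] by simp
    then show "\<exists>c \<in> x \<rightarrow> inf y z. w \<le> c"
      using below by blast
  qed
next
  fix x y z :: 'a
  assume conds: ?conditions
  assume xz: "inf x z \<le> y"
  obtain a where "a \<in> x \<rightarrow> x" "z \<le> a"
  proof -
    have "{z} \<sqinter>\<^sub>s (x \<rightarrow> x) \<approx>\<^sub>1 {z}"
      using conds by blast
    then show thesis
      using that by (auto simp: approx1_def le1_def set_meet_def)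
  qed
  moreover obtain b where "b \<in> x \<rightarrow> z" "z \<le> b"
  proof -
    have "(x \<rightarrow> z) \<sqinter>\<^sub>s {z} \<approx>\<^sub>1 {z}"
      using conds by blast
    then show thesis
      using that by (auto simp: approx1_def le1_def set_meet_def)
  qed
  ultimately have "inf a b \<in> (x \<rightarrow> x) \<sqinter>\<^sub>s (x \<rightarrow> z)" and z: "z \<le> inf a b"
    by (auto simp: set_meet_def)
  moreover have "(x \<rightarrow> x) \<sqinter>\<^sub>s (x \<rightarrow> z) \<le>\<^sub>1 x \<rightarrow> inf x z"
    using conds unfolding approx1_def by blast
  ultimately obtain c where "c \<in> x \<rightarrow> inf x z" "inf a b \<le> c"
    unfolding le1_def by blast
  moreover have "x \<rightarrow> inf x z \<le>\<^sub>1 x \<rightarrow> y"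
    using conds xz by blast
  ultimately obtain m where m: "m \<in> x \<rightarrow> y" "c \<le> m"
    unfolding le1_def by blast
  note z
  also note \<open>inf a b \<le> c\<close>
  also note \<open>c \<le> m\<close>
  finally show "\<exists>m \<in> x \<rightarrow> y. z \<le> m"
    using m(1) by blast
next
  fix x y z
  assume conds: ?conditions
  assume "\<exists>m \<in> x \<rightarrow> y. z \<le> m"
  then obtain m where m: "m \<in> x \<rightarrow> y" "z \<le> m"
    by blast
  have "inf x z \<le> inf x m"
    using m by (simp add: le_infI2)
  also have "{x} \<sqinter>\<^sub>s (x \<rightarrow> y) \<le>\<^sub>1 {inf x y}"
    using conds unfolding approx1_def by blast
  then have "inf x m \<le> inf x y"
    using m by (auto simp: le1_def set_meet_def)
  also have "inf x y \<le> y"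
    by simp
  finally show "inf x z \<le> y" .
qed

theorem theorem4p6:
  fixes imp :: "'a::{semilattice_inf, order_bot} \<Rightarrow> 'a \<Rightarrow> 'a set"  (infixr "\<rightarrow>" 75)
  assumes "ACC TYPE('a)"
    and "\<And>x y. x \<rightarrow> y \<noteq> {}"
  shows "(\<forall>x y. x \<rightarrow> y = maximal_elements {z. inf x z \<le> y}) \<longleftrightarrow>
    (\<forall>x y z.
      antichain (x \<rightarrow> y) \<and>
      {x} \<sqinter>\<^sub>s (x \<rightarrow> y) \<approx>\<^sub>1 {inf x y} \<and>
      (x \<rightarrow> y) \<sqinter>\<^sub>s {y} \<approx>\<^sub>1 {y} \<and>
      x \<rightarrow> inf y z \<approx>\<^sub>1 (x \<rightarrow> y) \<sqinter>\<^sub>s (x \<rightarrow> z) \<and>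
      {x} \<sqinter>\<^sub>s (y \<rightarrow> y) \<approx>\<^sub>1 {x} \<and>
      (y \<le> z \<longrightarrow> x \<rightarrow> y \<le>\<^sub>1 x \<rightarrow> z))"
proof -
  have "x \<rightarrow> y = maximal_elements {z. inf x z \<le> y} \<longleftrightarrow>
      antichain (x \<rightarrow> y) \<and> (\<forall>z. inf x z \<le> y \<longleftrightarrow> (\<exists>m \<in> x \<rightarrow> y. z \<le> m))" for x y
  proof -
    have "a \<in> {z. inf x z \<le> y}" if "b \<in> {z. inf x z \<le> y}" "a \<le> b" for a b
    proof -
      have "inf x a \<le> inf x b"
        using that by (simp add: le_infI2)
      also have "\<dots> \<le> y"
        using that by simp
      finally show ?thesis
        by simp
    qed
    from eq_maximal_elements_iff[OF assms(1) this] show ?thesis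
      by simp
  qed
  then have "(\<forall>x y. x \<rightarrow> y = maximal_elements {z. inf x z \<le> y}) \<longleftrightarrow>
      (\<forall>x y. antichain (x \<rightarrow> y)) \<and>
      (\<forall>x y z. inf x z \<le> y \<longleftrightarrow> (\<exists>m \<in> x \<rightarrow> y. z \<le> m))"
    by (simp only: all_conj_distrib)
  then show ?thesis
    by (simp only: residuation_iff all_conj_distrib simp_thms)
qed

end
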